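(* Let $0\leq \alpha<1$ and let $a$ be a real number with $\frac{1-2\alpha}{2-2\alpha}<a<\frac{3-2\alpha}{2-2\alpha}$. Then $$\mathbb{D}(a;r_{a})\subseteq G_{\alpha}(\mathbb{D})\subseteq \mathbb{D}(a;R_{a}),$$ where $r_a$ and $R_a$ are given by $$r_{a}=\begin{cases} a-1+\dfrac{1}{1-\alpha}, & \dfrac{1-2\alpha}{2-2\alpha}< a\leq 1-\dfrac{4\alpha }{(1-\alpha)(1+6\alpha+\alpha^2)},\\[2mm] \sqrt{s(\alpha, a)}, & 1-\dfrac{4\alpha }{(1-\alpha)(1+6\alpha+\alpha^2)}< a< 1+\dfrac{4\alpha }{(1-\alpha)(1+6\alpha+\alpha^2)},\\[2mm] 1-a+\dfrac{1}{1-\alpha}, & 1+\dfrac{4\alpha }{(1-\alpha)(1+6\alpha+\alpha^2)}\leq a <\dfrac{3-2\alpha}{2-2\alpha},\end{cases}$$ $$R_{a}=\begin{cases} 1-a+\dfrac{1}{1-\alpha}, & \dfrac{1-2\alpha}{2-2\alpha}<a\leq 1,\\[2mm] a-1+\dfrac{1}{1-\alpha}, & 1\leq a< \dfrac{3-2\alpha}{2-2\alpha},\end{cases}$$ with, for $\alpha\neq 0$, $$s(\alpha, a)=\dfrac{\sqrt{\alpha [\alpha- (1-a)^2 (1-\alpha ^2)^2]}+ \alpha \left(1+2 (1+\alpha)^2(1-a)^2\right)}{2\alpha (1+\alpha)^2}.$$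
   Context: $\mathbb{D}=\{z\in\mathbb{C}:|z|<1\}$ is the open unit disc and $\mathbb{D}(a;r)=\{z\in\mathbb{C}:|z-a|<r\}$ is the open disc of radius $r$ centered at $a$. For $0\leq\alpha<1$, $G_\alpha:\mathbb{D}\to\mathbb{C}$ is the function $G_\alpha(z)=1+\dfrac{z}{1-\alpha z^2}$. (For $\alpha=0$ the middle range in the definition of $r_a$ is empty, so $s(\alpha,a)$ is only needed for $\alpha\ne0$.) *)

theory Defs
  imports "HOL-Analysis.Analysis"
begin

definition G :: "real \<Rightarrow> complex \<Rightarrow> complex" where
  "G \<alpha> z = 1 + z / (1 - complex_of_real \<alpha> * z\<^sup>2)"

(* Only relevant for \<alpha> \<noteq> 0: for \<alpha> = 0 the middle case of inner_radius is vacuous. *)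
definition s :: "real \<Rightarrow> real \<Rightarrow> real" where
  "s \<alpha> a =
     (sqrt (\<alpha> * (\<alpha> - (1 - a)\<^sup>2 * (1 - \<alpha>\<^sup>2)\<^sup>2)) + \<alpha> * (1 + 2 * (1 + \<alpha>)\<^sup>2 * (1 - a)\<^sup>2))
     / (2 * \<alpha> * (1 + \<alpha>)\<^sup>2)"

(* The radii are meant for (1 - 2\<alpha>)/(2 - 2\<alpha>) < a < (3 - 2\<alpha>)/(2 - 2\<alpha>); these outer bounds are
   hypotheses of the theorem, so the first and last cases do not repeat them. Where two cases
   of the mathematical definition overlap (a = 1 for outer_radius, and a = 1 with \<alpha> = 0 for
   inner_radius) their values agree. *)
definition inner_radius :: "real \<Rightarrow> real \<Rightarrow> real" where
  "inner_radius \<alpha> a =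
     (if a \<le> 1 - 4 * \<alpha> / ((1 - \<alpha>) * (1 + 6 * \<alpha> + \<alpha>\<^sup>2)) then a - 1 + 1 / (1 - \<alpha>)
      else if a < 1 + 4 * \<alpha> / ((1 - \<alpha>) * (1 + 6 * \<alpha> + \<alpha>\<^sup>2)) then sqrt (s \<alpha> a)
      else 1 - a + 1 / (1 - \<alpha>))"

definition outer_radius :: "real \<Rightarrow> real \<Rightarrow> real" where
  "outer_radius \<alpha> a = (if a \<le> 1 then 1 - a + 1 / (1 - \<alpha>) else a - 1 + 1 / (1 - \<alpha>))"

end

theory Submission
  imports Defs
begin

text \<open>Put \<open>w = z / (1 - \<alpha> z\<^sup>2)\<close>, \<open>p = 1 / (1 - \<alpha>)\<close>, \<open>q = 1 / (1 + \<alpha>)\<close> and \<open>b = a - 1\<close>. Since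
  \<open>1 / w = 1 / z - \<alpha> z\<close> maps the disc onto the exterior of an ellipse, the image \<open>G\<^sub>\<alpha>(\<D>) - 1\<close> contains
  every \<open>w = u + i v\<close> with \<open>\<rho>\<^sup>2 < p\<^sup>2 u\<^sup>2 + q\<^sup>2 v\<^sup>2\<close>, where \<open>\<rho> = u\<^sup>2 + v\<^sup>2\<close>. In the coordinates
  \<open>(u, \<rho>)\<close> the complement of this region lies above a branch of the hyperbola
  \<open>\<rho>\<^sup>2 - q\<^sup>2 \<rho> = (p\<^sup>2 - q\<^sup>2) u\<^sup>2\<close>, while \<open>\<bar>w - b\<bar>\<^sup>2 = \<rho> - 2 b u + b\<^sup>2\<close> is linear. Its minimum over the
  complement is attained either at a point of tangency (Cauchy--Schwarz, middle case of the inner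
  radius) or at the vertex \<open>u = \<plusminus>p\<close> of the lemniscate (outer cases). The outer radius comes from
  \<open>\<bar>w\<bar> < p\<close>.\<close>

section \<open>Solving for a preimage inside the lemniscate\<close>

text \<open>A suitable root has \<open>\<alpha> * t \<le> 1\<close> for
  \<open>t = (norm z)\<^sup>2\<close>. If \<open>t\<close> were at least 1, then
  \<open>(1 - \<alpha> * t) / (1 - \<alpha>)\<close> and
  \<open>(1 + \<alpha> * t) / (1 + \<alpha>)\<close> would have squares at most \<open>t\<close>,
  which reverses the strict inequality on \<open>w\<close>; for \<open>w = 0\<close> the root is
  0.\<close>

lemma lemniscate_subset_image:
  fixes \<alpha> :: real and w :: complex
  assumes \<alpha>: "0 \<le> \<alpha>" "\<alpha> < 1"
    and w: "w = 0 \<or> ((Re w)\<^sup>2 + (Im w)\<^sup>2)\<^sup>2 < (Re w / (1 - \<alpha>))\<^sup>2 + (Im w / (1 + \<alpha>))\<^sup>2"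
  shows "\<exists>z. norm z < 1 \<and> w = z / (1 - of_real \<alpha> * z\<^sup>2)"
proof -
  \<comment> \<open>The root of \<open>\<alpha> w z\<^sup>2 + z - w = 0\<close> of smaller modulus, in a form that is also valid for \<open>\<alpha> w = 0\<close>.\<close>
  define d where "d = csqrt (1 + 4 * of_real \<alpha> * w\<^sup>2)"
  define z where "z = 2 * w / (1 + d)"
  have d2: "d\<^sup>2 = 1 + 4 * of_real \<alpha> * w\<^sup>2" by (simp add: d_def)
  have Re_d: "0 \<le> Re d"
    unfolding d_def using csqrt_principal[of "1 + 4 * of_real \<alpha> * w\<^sup>2"] by linarith
  have d1: "1 + d \<noteq> 0"
    using Re_d by (auto simp: complex_eq_iff)
  have "of_real \<alpha> * z\<^sup>2 = (d\<^sup>2 - 1) / (1 + d)\<^sup>2"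
    unfolding d2 z_def by (simp add: power_divide power_mult_distrib)
  also have "d\<^sup>2 - 1 = (d - 1) * (1 + d)"
    by (simp add: power2_eq_square algebra_simps)
  also have "(d - 1) * (1 + d) / (1 + d)\<^sup>2 = (d - 1) / (1 + d)"
    using d1 by (simp add: power2_eq_square)
  finally have \<alpha>z2: "of_real \<alpha> * z\<^sup>2 = (d - 1) / (1 + d)" .
  have "1 - of_real \<alpha> * z\<^sup>2 = 2 / (1 + d)"
    unfolding \<alpha>z2 using d1 by (simp add: field_simps)
  then have wz: "w = z / (1 - of_real \<alpha> * z\<^sup>2)" and nz: "1 - of_real \<alpha> * z\<^sup>2 \<noteq> 0"
    using d1 by (simp_all add: z_def)
  \<comment> \<open>A point of the closed right half-plane is at least as close to 1 as to
    -1.\<close>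
  have "norm (d - 1) \<le> norm (1 + d)"
    using Re_d by (simp add: cmod_def power2_eq_square algebra_simps)
  then have "norm (of_real \<alpha> * z\<^sup>2) \<le> 1"
    unfolding \<alpha>z2 norm_divide using d1 by (simp add: divide_le_eq)
  then have \<alpha>t: "\<alpha> * (norm z)\<^sup>2 \<le> 1"
    using \<alpha> by (simp add: norm_mult norm_power)
  have "norm z < 1"
  proof (rule ccontr)
    assume "\<not> norm z < 1"
    then have z1: "1 \<le> norm z" by simp
    define x y t where "x = Re z" and "y = Im z" and "t = x\<^sup>2 + y\<^sup>2"
    have t: "(norm z)\<^sup>2 = t" by (simp add: t_def x_def y_def cmod_power2)
    have t1: "1 \<le> t" using z1 unfolding t[symmetric] by (simp add: one_le_power)
    have \<alpha>t1: "\<alpha> * t \<le> 1" using \<alpha>t t by simp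
    define n where "n = 1 - of_real \<alpha> * z\<^sup>2"
    define N where "N = (norm n)\<^sup>2"
    have N: "N > 0" using nz by (simp add: N_def n_def)
    \<comment> \<open>Rationalising separates the coordinates, since \<open>z * cnj n\<close> equals
      \<open>z - \<alpha> * t * cnj z\<close>.\<close>
    have "w = z * cnj n / of_real N"
      using wz complex_div_cnj[of z n] by (simp add: N_def n_def)
    moreover have "Re (z * cnj n) = x * (1 - \<alpha> * t)" "Im (z * cnj n) = y * (1 + \<alpha> * t)"
      by (simp_all add: n_def x_def y_def t_def power2_eq_square algebra_simps)
    ultimately have uv: "Re w = x * (1 - \<alpha> * t) / N" "Im w = y * (1 + \<alpha> * t) / N"
      by simp_all
    have "(norm w)\<^sup>2 = t / N"
      using wz by (simp add: norm_divide power_divide t N_def n_def)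
    then have \<rho>: "(Re w)\<^sup>2 + (Im w)\<^sup>2 = t / N"
      by (simp add: cmod_power2)
    have "(1 - \<alpha> * t)\<^sup>2 \<le> (1 - \<alpha>)\<^sup>2"
      using \<alpha>t1 mult_left_mono[OF t1 \<alpha>(1)] by (intro power_mono) simp_all
    also have "\<dots> \<le> t * (1 - \<alpha>)\<^sup>2"
      using mult_right_mono[OF t1, of "(1 - \<alpha>)\<^sup>2"] by simp
    finally have A: "((1 - \<alpha> * t) / (1 - \<alpha>))\<^sup>2 \<le> t"
      using \<alpha> by (simp add: power_divide divide_le_eq)
    have "\<alpha> * (\<alpha> * t) \<le> 1" using mult_left_le[OF \<alpha>t1 \<alpha>(1)] \<alpha>(2) by linarith
    \<comment> \<open>This product is exactly
      \<open>t * (1 + \<alpha>)\<^sup>2 - (1 + \<alpha> * t)\<^sup>2\<close>.\<close>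
    then have "0 \<le> (t - 1) * (1 - \<alpha> * (\<alpha> * t))" using t1 by simp
    then have "(1 + \<alpha> * t)\<^sup>2 \<le> t * (1 + \<alpha>)\<^sup>2" by (simp add: power2_eq_square algebra_simps)
    then have B: "((1 + \<alpha> * t) / (1 + \<alpha>))\<^sup>2 \<le> t"
      using \<alpha> by (simp add: power_divide divide_le_eq)
    have "(Re w / (1 - \<alpha>))\<^sup>2 + (Im w / (1 + \<alpha>))\<^sup>2
        = (x\<^sup>2 * ((1 - \<alpha> * t) / (1 - \<alpha>))\<^sup>2 + y\<^sup>2 * ((1 + \<alpha> * t) / (1 + \<alpha>))\<^sup>2) / N\<^sup>2"
      unfolding uv by (simp add: power_divide power_mult_distrib add_divide_distrib[of _ _ "N\<^sup>2"] mult.commute)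
    also have "\<dots> \<le> (x\<^sup>2 * t + y\<^sup>2 * t) / N\<^sup>2"
      using A B by (intro divide_right_mono add_mono mult_left_mono) auto
    also have "\<dots> = (t / N)\<^sup>2"
      by (simp add: t_def power2_eq_square algebra_simps)
    finally have "w = 0" using w unfolding \<rho> by auto
    then have "z = 0" using wz nz by simp
    then show False using z1 by simp
  qed
  with wz show ?thesis by blast
qed

section \<open>Minimising a linear function beyond a hyperbola branch\<close>

text \<open>Cauchy-Schwarz for \<open>(h, sqrt D * u)\<close> against the vector
  \<open>(k, c)\<close>, which is a unit vector because \<open>4 * b\<^sup>2 \<le> D\<close> keeps
  the radicand of \<open>k\<close> nonnegative.\<close>

lemma hyperbola_tangent_bound:
  fixes D b h u T :: real
  assumes "0 < D" "4 * b\<^sup>2 \<le> D" "0 \<le> T" and T: "D * u\<^sup>2 + h\<^sup>2 \<le> T\<^sup>2"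
  shows "h * sqrt (1 - 4 * b\<^sup>2 / D) + 2 * b * u \<le> T"
proof -
  define c k X where "c = 2 * b / sqrt D" and "k = sqrt (1 - 4 * b\<^sup>2 / D)" and "X = sqrt D * u"
  have "c\<^sup>2 + k\<^sup>2 = 1"
    using assms by (simp add: c_def k_def power_divide power_mult_distrib)
  then have "X\<^sup>2 + h\<^sup>2 = (X\<^sup>2 + h\<^sup>2) * (c\<^sup>2 + k\<^sup>2)" by simp
  also have "\<dots> = (h * k + c * X)\<^sup>2 + (k * X - c * h)\<^sup>2"
    by (simp add: power2_eq_square algebra_simps)
  finally have "(h * k + c * X)\<^sup>2 \<le> X\<^sup>2 + h\<^sup>2" by simp
  also have "X\<^sup>2 + h\<^sup>2 \<le> T\<^sup>2" using T \<open>0 < D\<close> by (simp add: X_def power_mult_distrib)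
  finally have "h * k + c * X \<le> T" using \<open>0 \<le> T\<close> by (rule power2_le_imp_le)
  moreover have "c * X = 2 * b * u" using \<open>0 < D\<close> by (simp add: c_def X_def)
  ultimately show ?thesis by (simp add: k_def)
qed

text \<open>The hyperbola and the parabola \<open>u\<^sup>2 = \<rho>\<close> meet at
  \<open>(p, p\<^sup>2)\<close>. For larger \<open>\<rho>\<close> the parabola bounds
  \<open>u\<close> and \<open>b \<le> p\<close> suffices; for smaller \<open>\<rho>\<close> the
  tangent of the hyperbola does, and the last hypothesis says that \<open>\<rho> - 2 * b * u\<close>
  does not decrease when moving down that tangent.\<close>

lemma hyperbola_vertex_bound:
  fixes p q b u \<rho> :: real
  assumes "0 < p" "0 \<le> b" "b \<le> p"
    and "q\<^sup>2 \<le> \<rho>" "u\<^sup>2 \<le> \<rho>" and hyp: "(p\<^sup>2 - q\<^sup>2) * u\<^sup>2 \<le> \<rho>\<^sup>2 - q\<^sup>2 * \<rho>"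
    and b: "(p\<^sup>2 - q\<^sup>2) * p \<le> b * (2 * p\<^sup>2 - q\<^sup>2)"
  shows "p\<^sup>2 - 2 * b * p \<le> \<rho> - 2 * b * u"
proof (cases "p\<^sup>2 \<le> \<rho>")
  case True
  define m where "m = sqrt \<rho>"
  have "0 \<le> \<rho>" using True by (meson order_trans zero_le_power2)
  then have m: "m\<^sup>2 = \<rho>" by (simp add: m_def)
  have "p \<le> m" "u \<le> m"
    using True assms(5) by (simp_all add: m_def real_le_rsqrt)
  have "0 \<le> (m - p) * (m + p - 2 * b)"
    using \<open>p \<le> m\<close> assms by simp
  moreover have "b * u \<le> b * m" using \<open>u \<le> m\<close> assms by (intro mult_left_mono) auto
  ultimately show ?thesis
    unfolding m[symmetric] by (simp add: power2_eq_square algebra_simps)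
next
  case False
  \<comment> \<open>Bound \<open>u\<close> by the tangent \<open>L\<close> of the hyperbola at \<open>(p, p\<^sup>2)\<close>.\<close>
  define D where "D = p\<^sup>2 - q\<^sup>2"
  define \<kappa> where "\<kappa> = (2 * p\<^sup>2 - q\<^sup>2) / (2 * D * p)"
  define L where "L = p + \<kappa> * (\<rho> - p\<^sup>2)"
  have D: "0 < D" using False assms by (simp add: D_def)
  have \<kappa>: "2 * D * p * \<kappa> = 2 * p\<^sup>2 - q\<^sup>2" using D \<open>0 < p\<close> by (simp add: \<kappa>_def)
  have "0 \<le> 2 * p\<^sup>2 - q\<^sup>2" using D zero_le_power2[of p] by (simp only: D_def)
  then have "0 \<le> \<kappa>" using D \<open>0 < p\<close> by (simp add: \<kappa>_def)
  \<comment> \<open>The goal is \<open>1 \<le> D * \<kappa>\<^sup>2\<close>: the gap between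
    \<open>D * L\<^sup>2\<close> and the hyperbola is \<open>D * \<kappa>\<^sup>2 - 1\<close> times
    a square, as tangency removes the lower-order terms.\<close>
  have "4 * p\<^sup>2 * (D * (D * \<kappa>\<^sup>2)) = (2 * D * p * \<kappa>)\<^sup>2"
    by (simp add: power2_eq_square algebra_simps)
  also have "\<dots> = 4 * p\<^sup>2 * D + (q\<^sup>2)\<^sup>2"
    unfolding \<kappa> by (simp add: D_def power2_eq_square algebra_simps)
  finally have "4 * p\<^sup>2 * D * 1 \<le> 4 * p\<^sup>2 * D * (D * \<kappa>\<^sup>2)"
    by (simp add: mult.assoc)
  then have D\<kappa>2: "1 \<le> D * \<kappa>\<^sup>2"
    using D \<open>0 < p\<close> by (subst (asm) mult_le_cancel_left_pos) auto
  have "D * L\<^sup>2 = D * p\<^sup>2 + (2 * D * p * \<kappa>) * (\<rho> - p\<^sup>2) + D * \<kappa>\<^sup>2 * (\<rho> - p\<^sup>2)\<^sup>2"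
    by (simp add: L_def power2_eq_square algebra_simps)
  also have "\<dots> = \<rho>\<^sup>2 - q\<^sup>2 * \<rho> + (D * \<kappa>\<^sup>2 - 1) * (\<rho> - p\<^sup>2)\<^sup>2"
    unfolding \<kappa> by (simp add: D_def power2_eq_square algebra_simps)
  finally have "\<rho>\<^sup>2 - q\<^sup>2 * \<rho> \<le> D * L\<^sup>2" using D\<kappa>2 by simp
  then have "D * u\<^sup>2 \<le> D * L\<^sup>2" using hyp by (simp add: D_def)
  then have "u\<^sup>2 \<le> L\<^sup>2" using D by simp
  \<comment> \<open>Comparing squares yields \<open>u \<le> L\<close> only for nonnegative
    \<open>L\<close>; here \<open>q\<^sup>2 \<le> \<rho>\<close> enters through
    \<open>p\<^sup>2 - \<rho> \<le> D\<close>.\<close>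
  moreover have "0 \<le> L"
  proof -
    have "\<kappa> * (p\<^sup>2 - \<rho>) \<le> \<kappa> * D"
      using \<open>0 \<le> \<kappa>\<close> assms by (intro mult_left_mono) (simp_all add: D_def)
    moreover have "2 * p * (\<kappa> * D) = 2 * p * p - q\<^sup>2"
      using \<kappa> by (simp add: power2_eq_square mult_ac)
    then have "2 * p * (\<kappa> * D) \<le> 2 * p * p" by simp
    then have "\<kappa> * D \<le> p" using \<open>0 < p\<close> by simp
    ultimately show ?thesis by (simp add: L_def algebra_simps)
  qed
  ultimately have "u \<le> L" by (rule power2_le_imp_le)
  then have "2 * b * u \<le> 2 * b * L" using assms by (intro mult_left_mono) auto
  moreover have "1 \<le> 2 * b * \<kappa>"
    using b D \<open>0 < p\<close> by (simp add: \<kappa>_def D_def le_divide_eq algebra_simps)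
  then have "1 * (p\<^sup>2 - \<rho>) \<le> 2 * b * \<kappa> * (p\<^sup>2 - \<rho>)"
    using False by (intro mult_right_mono) auto
  ultimately show ?thesis by (simp add: L_def algebra_simps)
qed

section \<open>Estimates for the two radii\<close>

lemma norm_image_less:
  fixes \<alpha> :: real and z :: complex
  assumes "0 \<le> \<alpha>" "\<alpha> < 1" "norm z < 1"
  shows "norm (z / (1 - of_real \<alpha> * z\<^sup>2)) < 1 / (1 - \<alpha>)"
proof -
  have "\<alpha> * (norm z)\<^sup>2 \<le> \<alpha> * 1"
    using assms by (intro mult_left_mono) (auto simp: power_le_one)
  moreover have "1 - \<alpha> * (norm z)\<^sup>2 \<le> norm (1 - of_real \<alpha> * z\<^sup>2)"
    using norm_triangle_ineq2[of 1 "of_real \<alpha> * z\<^sup>2"] assms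
    by (simp add: norm_mult norm_power)
  ultimately have "1 - \<alpha> \<le> norm (1 - of_real \<alpha> * z\<^sup>2)" by simp
  then show ?thesis
    using assms by (simp add: norm_divide frac_less)
qed

text \<open>In the middle range this makes the radicand in \<open>s\<close> nonnegative. With
  \<open>r = sqrt \<alpha>\<close>, the square of \<open>1 + \<alpha> - 2 * r\<close> shows that the
  threshold times \<open>1 - \<alpha>\<^sup>2\<close> is at most \<open>r\<close>.\<close>

lemma sqrt_s_threshold:
  fixes \<alpha> b :: real
  assumes "0 \<le> \<alpha>" "\<alpha> < 1" and b: "\<bar>b\<bar> < 4 * \<alpha> / ((1 - \<alpha>) * (1 + 6 * \<alpha> + \<alpha>\<^sup>2))"
  shows "(b * (1 - \<alpha>\<^sup>2))\<^sup>2 \<le> \<alpha>"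
proof -
  have pos: "0 < 1 + 6 * \<alpha> + \<alpha>\<^sup>2" using assms by (simp add: add_pos_nonneg)
  define r where "r = sqrt \<alpha>"
  have r: "0 \<le> r" "r\<^sup>2 = \<alpha>" using assms by (simp_all add: r_def)
  have "0 \<le> (1 + \<alpha> - 2 * r)\<^sup>2" by simp
  also have "\<dots> = 1 + 2 * \<alpha> + \<alpha>\<^sup>2 + 4 * r\<^sup>2 - 4 * r * (1 + \<alpha>)"
    by (simp add: power2_eq_square algebra_simps)
  finally have r4: "4 * r * (1 + \<alpha>) \<le> 1 + 6 * \<alpha> + \<alpha>\<^sup>2" using r by simp
  have "1 - \<alpha>\<^sup>2 = (1 - \<alpha>) * (1 + \<alpha>)" by (simp add: power2_eq_square algebra_simps)
  then have "\<bar>b * (1 - \<alpha>\<^sup>2)\<bar> = \<bar>b\<bar> * (1 - \<alpha>) * (1 + \<alpha>)"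
    using assms by (simp add: abs_mult)
  also have "\<bar>b\<bar> * (1 - \<alpha>) * (1 + \<alpha>) \<le> 4 * \<alpha> / (1 + 6 * \<alpha> + \<alpha>\<^sup>2) * (1 + \<alpha>)"
  proof -
    have "\<bar>b\<bar> < 4 * \<alpha> / (1 + 6 * \<alpha> + \<alpha>\<^sup>2) / (1 - \<alpha>)"
      using b by (simp add: mult.commute)
    then have "\<bar>b\<bar> * (1 - \<alpha>) \<le> 4 * \<alpha> / (1 + 6 * \<alpha> + \<alpha>\<^sup>2)"
      using assms by (subst (asm) pos_less_divide_eq) auto
    then show ?thesis
      using assms by (intro mult_right_mono) auto
  qed
  also have "\<dots> = r * (4 * r * (1 + \<alpha>)) / (1 + 6 * \<alpha> + \<alpha>\<^sup>2)"
    unfolding r(2)[symmetric] by (simp add: power2_eq_square)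
  also have "\<dots> \<le> r * (1 + 6 * \<alpha> + \<alpha>\<^sup>2) / (1 + 6 * \<alpha> + \<alpha>\<^sup>2)"
    using r r4 pos by (intro divide_right_mono mult_left_mono) auto
  finally have "\<bar>b * (1 - \<alpha>\<^sup>2)\<bar> \<le> r" using pos by simp
  then have "(b * (1 - \<alpha>\<^sup>2))\<^sup>2 \<le> r\<^sup>2" using power2_le_iff_abs_le[OF r(1)] by blast
  then show ?thesis using r by simp
qed

text \<open>Rewrites \<open>s\<close> as the lower bound for the squared distance that
  \<open>hyperbola_tangent_bound\<close> delivers; the closed form of \<open>D\<close> translates
  \<open>sqrt_s_threshold\<close> into \<open>4 * b\<^sup>2 \<le> D\<close> for
  \<open>b = a - 1\<close>.\<close>

lemma s_eq:
  fixes \<alpha> a D :: real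
  assumes "0 < \<alpha>" "\<alpha> < 1" and D: "D = (1 / (1 - \<alpha>))\<^sup>2 - (1 / (1 + \<alpha>))\<^sup>2"
  shows "s \<alpha> a = (1 / (1 + \<alpha>))\<^sup>2 / 2 * (1 + sqrt (1 - 4 * (a - 1)\<^sup>2 / D)) + (a - 1)\<^sup>2"
    and "D = 4 * \<alpha> / (1 - \<alpha>\<^sup>2)\<^sup>2"
proof -
  have f: "1 - \<alpha>\<^sup>2 = (1 - \<alpha>) * (1 + \<alpha>)" by (simp add: power2_eq_square algebra_simps)
  have nz: "1 - \<alpha> \<noteq> 0" "1 + \<alpha> \<noteq> 0" using assms by auto
  show D': "D = 4 * \<alpha> / (1 - \<alpha>\<^sup>2)\<^sup>2"
    unfolding D f using nz by (simp add: divide_simps) (simp add: power2_eq_square algebra_simps)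
  have "\<alpha> * (\<alpha> - (1 - a)\<^sup>2 * (1 - \<alpha>\<^sup>2)\<^sup>2) = \<alpha>\<^sup>2 * (1 - 4 * (a - 1)\<^sup>2 / D)"
    unfolding D' using assms by (simp add: power2_commute[of 1 a] field_simps power2_eq_square)
  then have "sqrt (\<alpha> * (\<alpha> - (1 - a)\<^sup>2 * (1 - \<alpha>\<^sup>2)\<^sup>2)) = \<alpha> * sqrt (1 - 4 * (a - 1)\<^sup>2 / D)"
    using assms by (simp add: real_sqrt_mult)
  then show "s \<alpha> a = (1 / (1 + \<alpha>))\<^sup>2 / 2 * (1 + sqrt (1 - 4 * (a - 1)\<^sup>2 / D)) + (a - 1)\<^sup>2"
    unfolding s_def using assms(1,2) nz
    by (simp only: power2_commute[of 1 a]) (simp add: power_divide field_simps)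
qed

text \<open>The inner inclusion in contrapositive form: nonzero points not strictly inside the
  lemniscate stay at least \<open>inner_radius\<close> away from the shifted centre.\<close>

lemma inner_radius_le_dist:
  fixes \<alpha> a :: real and w :: complex
  assumes \<alpha>: "0 \<le> \<alpha>" "\<alpha> < 1"
    and a: "\<bar>a - 1\<bar> \<le> 1 / (1 - \<alpha>)"
    and w: "w \<noteq> 0" "(Re w / (1 - \<alpha>))\<^sup>2 + (Im w / (1 + \<alpha>))\<^sup>2 \<le> ((Re w)\<^sup>2 + (Im w)\<^sup>2)\<^sup>2"
  shows "inner_radius \<alpha> a \<le> norm (w - of_real (a - 1))"
proof -
  define b u \<rho> where "b = a - 1" and "u = Re w" and "\<rho> = (Re w)\<^sup>2 + (Im w)\<^sup>2"
  define p q D where "p = 1 / (1 - \<alpha>)" and "q = 1 / (1 + \<alpha>)" and "D = p\<^sup>2 - q\<^sup>2"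
  define \<tau> where "\<tau> = 4 * \<alpha> / ((1 - \<alpha>) * (1 + 6 * \<alpha> + \<alpha>\<^sup>2))"
  have p: "0 < p" using \<alpha> by (simp add: p_def)
  have q: "0 < q" "q \<le> p" using \<alpha> by (simp_all add: p_def q_def frac_le)
  have D0: "0 \<le> D" using q by (simp add: D_def power_mono)
  have dist: "(norm (w - of_real (a - 1)))\<^sup>2 = \<rho> - 2 * b * u + b\<^sup>2"
    unfolding cmod_power2 b_def[symmetric] by (simp add: \<rho>_def u_def power2_diff)
  have \<rho>: "0 < \<rho>" using w(1) by (auto simp: \<rho>_def sum_power2_gt_zero_iff complex_eq_iff)
  have u\<rho>: "u\<^sup>2 \<le> \<rho>" by (simp add: u_def \<rho>_def)
  have "(Re w / (1 - \<alpha>))\<^sup>2 + (Im w / (1 + \<alpha>))\<^sup>2 = D * u\<^sup>2 + q\<^sup>2 * \<rho>"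
    by (simp add: D_def p_def q_def u_def \<rho>_def power_divide algebra_simps)
  then have hyp: "D * u\<^sup>2 \<le> \<rho>\<^sup>2 - q\<^sup>2 * \<rho>" using w(2) by (simp add: \<rho>_def)
  \<comment> \<open>Selects the upper branch of the hyperbola; \<open>w \<noteq> 0\<close> excludes
    \<open>\<rho> = 0\<close>.\<close>
  then have "0 \<le> \<rho> * (\<rho> - q\<^sup>2)"
    using mult_nonneg_nonneg[OF D0 zero_le_power2[of u]]
    by (simp add: power2_eq_square[of \<rho>] algebra_simps)
  then have q\<rho>: "q\<^sup>2 \<le> \<rho>" using \<rho> by (simp add: zero_le_mult_iff)
  have vertex: "p - \<bar>b\<bar> \<le> norm (w - of_real (a - 1))" if "\<tau> \<le> \<bar>b\<bar>"
  proof -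
    have f: "2 * p\<^sup>2 - q\<^sup>2 = (1 + 6 * \<alpha> + \<alpha>\<^sup>2) / ((1 - \<alpha>) * (1 + \<alpha>))\<^sup>2"
      "D = 4 * \<alpha> / ((1 - \<alpha>) * (1 + \<alpha>))\<^sup>2"
      unfolding D_def p_def q_def using \<alpha>
      by (simp_all add: divide_simps) (simp_all add: power2_eq_square algebra_simps)
    have pos: "0 < 1 + 6 * \<alpha> + \<alpha>\<^sup>2" using \<alpha> by (simp add: add_pos_nonneg)
    have "0 \<le> 2 * p\<^sup>2 - q\<^sup>2" unfolding f using pos by simp
    then have "\<tau> * (2 * p\<^sup>2 - q\<^sup>2) \<le> \<bar>b\<bar> * (2 * p\<^sup>2 - q\<^sup>2)"
      using that by (rule mult_right_mono[rotated])
    \<comment> \<open>So \<open>\<tau>\<close> is the value of \<open>\<bar>b\<bar>\<close> that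
      gives equality in the last hypothesis of \<open>hyperbola_vertex_bound\<close>.\<close>
    moreover have "\<tau> * (2 * p\<^sup>2 - q\<^sup>2) = D * p"
      unfolding f \<tau>_def using pos by (simp add: p_def)
    ultimately have b: "(p\<^sup>2 - q\<^sup>2) * p \<le> \<bar>b\<bar> * (2 * p\<^sup>2 - q\<^sup>2)" by (simp add: D_def)
    \<comment> \<open>Reflecting \<open>u\<close> by the sign of \<open>b\<close> reduces to a
      nonnegative centre and covers both outer cases.\<close>
    have "p\<^sup>2 - 2 * \<bar>b\<bar> * p \<le> \<rho> - 2 * \<bar>b\<bar> * (sgn b * u)"
    proof (rule hyperbola_vertex_bound[OF p _ _ q\<rho> _ _ b])
      show "\<bar>b\<bar> \<le> p" using a by (simp add: b_def p_def)
      have "(sgn b * u)\<^sup>2 \<le> u\<^sup>2"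
        by (simp add: power_mult_distrib sgn_if)
      then show "(sgn b * u)\<^sup>2 \<le> \<rho>" "(p\<^sup>2 - q\<^sup>2) * (sgn b * u)\<^sup>2 \<le> \<rho>\<^sup>2 - q\<^sup>2 * \<rho>"
        using u\<rho> hyp mult_left_mono[OF _ D0] unfolding D_def by (meson order_trans)+
    qed simp
    also have "2 * \<bar>b\<bar> * (sgn b * u) = 2 * b * u" by (simp add: sgn_if)
    finally have "(p - \<bar>b\<bar>)\<^sup>2 \<le> (norm (w - of_real (a - 1)))\<^sup>2"
      unfolding dist by (simp add: power2_diff mult.commute mult.left_commute)
    then show ?thesis by (rule power2_le_imp_le) simp
  qed
  have "0 \<le> \<tau>" using \<alpha> by (simp add: \<tau>_def)
  consider "a \<le> 1 - \<tau>" | "1 - \<tau> < a" "a < 1 + \<tau>" | "1 - \<tau> < a" "1 + \<tau> \<le> a" by linarith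
  then show ?thesis
  proof cases
    case 1
    then show ?thesis using vertex \<open>0 \<le> \<tau>\<close>
      by (simp add: inner_radius_def \<tau>_def[symmetric] b_def p_def)
  next
    case 2
    then have b\<tau>: "\<bar>b\<bar> < \<tau>" by (auto simp: b_def)
    then have "0 < \<alpha>" using \<alpha> by (cases "\<alpha> = 0") (auto simp: \<tau>_def)
    note s = s_eq[OF this \<alpha>(2) D_def[unfolded p_def q_def]]
    have "0 < 1 - \<alpha>\<^sup>2" using \<alpha> by (simp add: power_less_one_iff abs_square_less_1)
    then have "0 < D" using \<open>0 < \<alpha>\<close> by (simp add: s(2))
    have "4 * b\<^sup>2 \<le> D"
      using sqrt_s_threshold[OF \<alpha> b\<tau>[unfolded \<tau>_def]] \<open>0 < 1 - \<alpha>\<^sup>2\<close>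
      by (simp add: s(2) le_divide_eq power_mult_distrib)
    \<comment> \<open>Completing the square in \<open>\<rho>\<close> turns \<open>hyp\<close> into
      the form required, with \<open>h = q\<^sup>2 / 2\<close> and
      \<open>T = \<rho> - q\<^sup>2 / 2\<close>.\<close>
    have "q\<^sup>2 / 2 * sqrt (1 - 4 * b\<^sup>2 / D) + 2 * b * u \<le> \<rho> - q\<^sup>2 / 2"
    proof (rule hyperbola_tangent_bound[OF \<open>0 < D\<close> \<open>4 * b\<^sup>2 \<le> D\<close>])
      show "0 \<le> \<rho> - q\<^sup>2 / 2" using q\<rho> zero_le_power2[of q] by linarith
      show "D * u\<^sup>2 + (q\<^sup>2 / 2)\<^sup>2 \<le> (\<rho> - q\<^sup>2 / 2)\<^sup>2"
        using hyp by (simp add: power2_diff mult.commute)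
    qed
    then have "s \<alpha> a \<le> (norm (w - of_real (a - 1)))\<^sup>2"
      unfolding dist unfolding s(1) q_def[symmetric] b_def[symmetric] by (simp add: algebra_simps)
    then show ?thesis
      using 2 by (simp add: inner_radius_def \<tau>_def[symmetric] real_le_lsqrt)
  next
    case 3
    then show ?thesis using vertex \<open>0 \<le> \<tau>\<close>
      by (simp add: inner_radius_def \<tau>_def[symmetric] b_def p_def)
  qed
qed

section \<open>The two inclusions\<close>

theorem lemma2p1:
  fixes \<alpha> a :: real
  assumes "0 \<le> \<alpha>" and "\<alpha> < 1"
    and "(1 - 2 * \<alpha>) / (2 - 2 * \<alpha>) < a" and "a < (3 - 2 * \<alpha>) / (2 - 2 * \<alpha>)"
  shows "ball (complex_of_real a) (inner_radius \<alpha> a) \<subseteq> G \<alpha> ` ball 0 1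
    \<and> G \<alpha> ` ball 0 1 \<subseteq> ball (complex_of_real a) (outer_radius \<alpha> a)"
proof
  define p where "p = 1 / (1 - \<alpha>)"
  \<comment> \<open>The range of \<open>a\<close> is the interval of half-width \<open>p / 2\<close>
    about 1.\<close>
  have "(1 - 2 * \<alpha>) / (2 - 2 * \<alpha>) = 1 - p / 2" "(3 - 2 * \<alpha>) / (2 - 2 * \<alpha>) = 1 + p / 2"
    using assms by (simp_all add: p_def field_simps)
  then have "1 - p / 2 < a" "a < 1 + p / 2" using assms(3,4) by simp_all
  moreover have "0 < p" using assms by (simp add: p_def)
  ultimately have a: "\<bar>a - 1\<bar> \<le> 1 / (1 - \<alpha>)" unfolding p_def[symmetric] by linarith
  show "ball (complex_of_real a) (inner_radius \<alpha> a) \<subseteq> G \<alpha> ` ball 0 1"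
  proof
    fix v assume "v \<in> ball (complex_of_real a) (inner_radius \<alpha> a)"
    moreover have "v - 1 - of_real (a - 1) = v - of_real a" by simp
    ultimately have "norm (v - 1 - of_real (a - 1)) < inner_radius \<alpha> a"
      by (simp only: mem_ball dist_norm norm_minus_commute)
    then have "v - 1 = 0 \<or> ((Re (v - 1))\<^sup>2 + (Im (v - 1))\<^sup>2)\<^sup>2
        < (Re (v - 1) / (1 - \<alpha>))\<^sup>2 + (Im (v - 1) / (1 + \<alpha>))\<^sup>2"
      using inner_radius_le_dist[OF assms(1,2) a, of "v - 1"] by linarith
    then obtain z where z: "norm z < 1" "v - 1 = z / (1 - of_real \<alpha> * z\<^sup>2)"
      using lemniscate_subset_image[OF assms(1,2)] by blast
    then have "v = G \<alpha> z" by (simp add: G_def flip: z(2))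
    then show "v \<in> G \<alpha> ` ball 0 1" using z(1) by simp
  qed
  show "G \<alpha> ` ball 0 1 \<subseteq> ball (complex_of_real a) (outer_radius \<alpha> a)"
  proof (rule image_subsetI)
    fix z :: complex assume "z \<in> ball 0 1"
    then have "norm (z / (1 - of_real \<alpha> * z\<^sup>2)) < 1 / (1 - \<alpha>)"
      using norm_image_less assms by simp
    \<comment> \<open>Both cases of the outer radius are \<open>\<bar>a - 1\<bar> + p\<close>, so
      the triangle inequality finishes.\<close>
    moreover have "outer_radius \<alpha> a = norm (of_real (a - 1) :: complex) + 1 / (1 - \<alpha>)"
      by (simp only: norm_of_real) (simp add: outer_radius_def)
    moreover have "of_real a - G \<alpha> z = of_real (a - 1) - z / (1 - of_real \<alpha> * z\<^sup>2)"
      by (simp add: G_def)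
    ultimately show "G \<alpha> z \<in> ball (of_real a) (outer_radius \<alpha> a)"
      using norm_triangle_ineq4[of "of_real (a - 1)" "z / (1 - of_real \<alpha> * z\<^sup>2)"]
      by (simp only: mem_ball dist_norm)
  qed
qed

end
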